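(* Let $\Delta$ be a power of $2$, let $k\ge 2$ be an integer, and let $M=H\otimes H$ where $H$ is the $\Delta\times\Delta$ Haar matrix (defined in the context). Let $\vec{v}\in\mathbb{R}^{\Delta^2}$ be a random vector whose entries are grouped by scale as in the context, such that: (i) the sub-vectors $\vec{v}_{m_1,m_2}$ for the different scales $(m_1,m_2)$ are mutually independent; (ii) within each scale $(m_1,m_2)$, every entry of $\vec{v}_{m_1,m_2}$ is a standard Gaussian random variable and any $k$ distinct entries of $\vec{v}_{m_1,m_2}$ are mutually independent. Then every entry of $\vec{z}=M^T\vec{v}$ is a standard Gaussian random variable and any $k$ distinct entries of $\vec{z}$ are mutually independent (i.e., are i.i.d. standard Gaussian).
   Context: The Haar matrix $H$: its rows are the vectors $\psi^m_j$ for $m=-1,0,\dots,\log_2\Delta-1$ and $j=0,\dots,2^{\max(0,m)}-1$, in dictionary order of $(m,j)$; $m$ is the scale of the row. Here $\psi^{-1}_0=\Delta^{-1/2}\mathbbm{1}_{[0,\Delta)}$ and, for $m\ge0$ with $I^m_j=\{j\Delta/2^m,\dots,(j+1)\Delta/2^m-1\}$, $\psi^m_j$ equals $\sqrt{2^m/\Delta}$ on the first half of $I^m_j$, $-\sqrt{2^m/\Delta}$ on the second half and $0$ elsewhere ($\mathbbm{1}_R$ is the 0-1 indicator vector of $R$). The rows of $M=H\otimes H$ (Kronecker product) are indexed by $r_1\Delta+r_2$ with $r_1,r_2\in\{0,\dots,\Delta-1\}$; if row $r_1$ of $H$ has scale $m_1$ and row $r_2$ of $H$ has scale $m_2$, row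 $r_1\Delta+r_2$ of $M$ (and the entry of $\vec{v}$ with the same index) is said to have scale $(m_1,m_2)$. $\vec{v}_{m_1,m_2}$ denotes the vector of entries of $\vec{v}$ of scale $(m_1,m_2)$. *)

theory Defs
  imports "HOL-Probability.Probability" "Jordan_Normal_Form.Matrix"
begin

unbundle no vec_syntax

(* Positions and rows are numbered from 0. Everything below is meant for \<Delta> a power of 2,
   where the floor of the logarithm is the logarithm and all divisions are exact. *)

definition haar_vec :: "nat \<Rightarrow> int \<Rightarrow> nat \<Rightarrow> real Matrix.vec" where
  "haar_vec \<Delta> m j = Matrix.vec \<Delta> (\<lambda>x.
     if m = -1 then 1 / sqrt (real \<Delta>)
     else let w = \<Delta> div 2 ^ nat m; a = sqrt (2 ^ nat m / real \<Delta>) in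
       if x \<in> {j * w ..< j * w + w div 2} then a
       else if x \<in> {j * w + w div 2 ..< (j + 1) * w} then - a
       else 0)"

(* The list comprehension enumerates the pairs (m, j) in dictionary order. *)
definition haar_labels :: "nat \<Rightarrow> (int \<times> nat) list" where
  "haar_labels \<Delta> = [(m, j). m \<leftarrow> [-1..\<lfloor>log 2 (real \<Delta>)\<rfloor> - 1], j \<leftarrow> [0..<2 ^ nat (max 0 m)]]"

definition haar_mat :: "nat \<Rightarrow> real Matrix.mat" where
  "haar_mat \<Delta> = mat_of_rows \<Delta> (map (\<lambda>(m, j). haar_vec \<Delta> m j) (haar_labels \<Delta>))"

definition haar_scale :: "nat \<Rightarrow> nat \<Rightarrow> int" where
  "haar_scale \<Delta> r = fst (haar_labels \<Delta> ! r)"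

definition haar_scales :: "nat \<Rightarrow> int set" where
  "haar_scales \<Delta> = {-1..\<lfloor>log 2 (real \<Delta>)\<rfloor> - 1}"

definition kronecker :: "'a::times Matrix.mat \<Rightarrow> 'a Matrix.mat \<Rightarrow> 'a Matrix.mat" where
  "kronecker A B = Matrix.mat (dim_row A * dim_row B) (dim_col A * dim_col B)
     (\<lambda>(i, j). A $$ (i div dim_row B, j div dim_col B) * B $$ (i mod dim_row B, j mod dim_col B))"

definition scale_indices :: "nat \<Rightarrow> int \<times> int \<Rightarrow> nat set" where
  "scale_indices \<Delta> = (\<lambda>(m1, m2). {r1 * \<Delta> + r2 | r1 r2.
     r1 < \<Delta> \<and> r2 < \<Delta> \<and> haar_scale \<Delta> r1 = m1 \<and> haar_scale \<Delta> r2 = m2})"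

(* The bound is "at most k" rather than "exactly k", so that the condition is not vacuous for
   families with fewer than k members (such as the entries of a coarse scale). For families
   with at least k members the two versions agree. *)
definition kwise_indep :: "'a measure \<Rightarrow> nat \<Rightarrow> ('i \<Rightarrow> 'a \<Rightarrow> real) \<Rightarrow> 'i set \<Rightarrow> bool" where
  "kwise_indep P k X I \<longleftrightarrow>
     (\<forall>J \<subseteq> I. finite J \<and> card J \<le> k \<longrightarrow> prob_space.indep_vars P (\<lambda>_. borel) X J)"

definition std_gaussian :: "'a measure \<Rightarrow> ('a \<Rightarrow> real) \<Rightarrow> bool" where
  "std_gaussian P X \<longleftrightarrow> distributed P lborel X (\<lambda>x. ennreal (std_normal_density x))"

end

theory Submission
  imports Defs
begin

text \<open>Each column of \<open>H\<close> has exactly one nonzero entry per scale, so \<open>k\<close> entries of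
  \<open>M\<^sup>T v\<close> involve at most \<open>k\<close> entries of \<open>v\<close> of each scale; together these are mutually
  independent standard Gaussians. As the columns of \<open>M\<close> are orthonormal, the joint characteristic
  function of the \<open>k\<close> entries at \<open>t\<close> is \<open>exp (- \<Sum>t\<^sub>i\<^sup>2 / 2)\<close>. It factorises, and this implies
  independence.\<close>

text \<open>The obstacle is that the whole of \<open>v\<close> need not be a Gaussian vector: inside
  a scale only k-wise independence is known, so rotation invariance of the Gaussian law cannot be
  applied to \<open>M\<close>. What survives concerns a combination of at most k entries of
  \<open>z\<close> with arbitrary weights \<open>t\<close>. Its coefficients on \<open>v\<close>
  vanish outside at most k indices of each scale, so it is a sum of independent Gaussians, and
  orthonormality turns the sum of its squared coefficients into the sum of the squared weights. The
  passage from a factorising characteristic function to independence uses Levy uniqueness on the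
  real line only: the factors belonging to the other coordinates are treated as a change of measure,
  under which the law of one coordinate must stay the same. Orthonormality is needed for the columns
  of \<open>H\<close>, not for its rows. It is obtained as completeness of the Haar system: at the
  finest level the projection kernel is the identity matrix.\<close>

section \<open>Independence from factorising characteristic functions\<close>

text \<open>Divided by its mean, \<open>w\<close> is a probability density. The hypothesis
  \<open>eq\<close> says that \<open>X\<close> has the same characteristic function under the
  reweighted measure as under \<open>M\<close>, hence the same law, and the two laws give
  \<open>B\<close> the same mass. If the mean is zero there is nothing to normalise, but then
  \<open>w\<close> vanishes almost everywhere.\<close>

lemma (in prob_space) expectation_mult_indicator_if_iexp_nonneg:
  fixes w X :: "'a \<Rightarrow> real"
  assumes X [measurable]: "random_variable borel X" and w [measurable]: "w \<in> borel_measurable M"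
    and w_nonneg: "\<And>\<omega>. 0 \<le> w \<omega>" and w_le: "\<And>\<omega>. w \<omega> \<le> C"
    and eq: "\<And>t. expectation (\<lambda>\<omega>. of_real (w \<omega>) * iexp (t * X \<omega>)) =
      of_real (expectation w) * expectation (\<lambda>\<omega>. iexp (t * X \<omega>))"
    and B [measurable]: "B \<in> sets borel"
  shows "expectation (\<lambda>\<omega>. w \<omega> * indicator B (X \<omega>)) =
    expectation w * expectation (\<lambda>\<omega>. indicator B (X \<omega>))"
proof (cases "expectation w = 0")
  case True
  have int_w: "integrable M w"
    by (rule integrable_const_bound[where B = C]) (auto simp: w_nonneg w_le)
  have "AE \<omega> in M. w \<omega> = 0"
    using True integral_nonneg_eq_0_iff_AE[OF int_w] w_nonneg by auto
  then have "expectation (\<lambda>\<omega>. w \<omega> * indicator B (X \<omega>)) = expectation (\<lambda>_. 0)"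
    by (intro integral_cong_AE) auto
  then show ?thesis using True by simp
next
  case False
  define c where "c = expectation w"
  have c: "c > 0"
    using False integral_nonneg_AE[of w M] w_nonneg by (auto simp: c_def less_le)
  have int_w: "integrable M w"
    by (rule integrable_const_bound[where B = C]) (auto simp: w_nonneg w_le)
  define N where "N = density M (\<lambda>\<omega>. ennreal (w \<omega> / c))"
  have [measurable]: "X \<in> borel_measurable N"
    unfolding N_def by simp
  interpret N: prob_space N
  proof
    have "emeasure N (space N) = (\<integral>\<^sup>+\<omega>. ennreal (w \<omega> / c) \<partial>M)"
      unfolding N_def by (simp add: emeasure_density cong: nn_integral_cong)
    also have "\<dots> = ennreal (\<integral>\<omega>. w \<omega> / c \<partial>M)"
      using c w_nonneg int_w by (intro nn_integral_eq_integral) auto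
    also have "\<dots> = 1"
      using c by (simp add: c_def[symmetric])
    finally show "emeasure N (space N) = 1" .
  qed
  have int_N: "integral\<^sup>L N (\<lambda>\<omega>. f (X \<omega>)) = (\<integral>\<omega>. (w \<omega> / c) *\<^sub>R f (X \<omega>) \<partial>M)"
    if [measurable]: "f \<in> borel_measurable borel" for f :: "real \<Rightarrow> 'b :: {banach, second_countable_topology}"
    unfolding N_def using c w_nonneg by (subst integral_density) auto
  have "distr N borel X = distr M borel X"
  proof (rule Levy_uniqueness)
    show "real_distribution (distr N borel X)" "real_distribution (distr M borel X)"
      by (auto intro: N.real_distribution_distr real_distribution_distr)
    show "char (distr N borel X) = char (distr M borel X)"
    proof
      fix t
      have "char (distr N borel X) t = (\<integral>\<omega>. iexp (t * X \<omega>) \<partial>N)"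
        by (simp add: char_def integral_distr)
      also have "\<dots> = expectation (\<lambda>\<omega>. (w \<omega> / c) *\<^sub>R iexp (t * X \<omega>))"
        by (rule int_N) simp
      also have "\<dots> = expectation (\<lambda>\<omega>. of_real (w \<omega>) * iexp (t * X \<omega>) / of_real c)"
        by (simp add: scaleR_conv_of_real)
      also have "\<dots> = expectation (\<lambda>\<omega>. of_real (w \<omega>) * iexp (t * X \<omega>)) / of_real c"
        by (rule integral_divide_zero)
      also have "\<dots> = char (distr M borel X) t"
        using c unfolding eq c_def[symmetric] by (simp add: char_def integral_distr)
      finally show "char (distr N borel X) t = char (distr M borel X) t" .
    qed
  qed
  then have "(\<integral>x. indicator B x \<partial>distr N borel X) = (\<integral>x. indicator B x \<partial>distr M borel X :: real)"
    by simp
  then have "(\<integral>\<omega>. indicator B (X \<omega>) \<partial>N) = expectation (\<lambda>\<omega>. indicator B (X \<omega>) :: real)"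
    by (simp only: integral_distr[OF \<open>X \<in> borel_measurable N\<close> borel_measurable_indicator[OF B]]
        integral_distr[OF X borel_measurable_indicator[OF B]])
  moreover have "(\<integral>\<omega>. indicator B (X \<omega>) \<partial>N) = expectation (\<lambda>\<omega>. (w \<omega> * indicator B (X \<omega>)) / c)"
    by (subst int_N) auto
  ultimately show ?thesis
    using c by (simp add: c_def[symmetric] field_simps)
qed

text \<open>Hypothesis and conclusion are both linear in \<open>w\<close> and hold for constants, so
  the weight can be shifted to \<open>w + C\<close>, which lies between 0 and
  \<open>2 * C\<close>.\<close>

lemma (in prob_space) expectation_mult_indicator_if_iexp_real:
  fixes w X :: "'a \<Rightarrow> real"
  assumes X [measurable]: "random_variable borel X" and w [measurable]: "w \<in> borel_measurable M"
    and w_le: "\<And>\<omega>. \<bar>w \<omega>\<bar> \<le> C"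
    and eq: "\<And>t. expectation (\<lambda>\<omega>. of_real (w \<omega>) * iexp (t * X \<omega>)) =
      of_real (expectation w) * expectation (\<lambda>\<omega>. iexp (t * X \<omega>))"
    and B [measurable]: "B \<in> sets borel"
  shows "expectation (\<lambda>\<omega>. w \<omega> * indicator B (X \<omega>)) =
    expectation w * expectation (\<lambda>\<omega>. indicator B (X \<omega>))"
proof -
  have int_w [simp]: "integrable M w"
    by (rule integrable_const_bound[where B = C]) (auto simp: w_le)
  have [simp]: "integrable M (\<lambda>\<omega>. w \<omega> * indicator B (X \<omega>))"
    using w_le order_trans[OF abs_ge_zero w_le]
    by (intro integrable_const_bound[where B = C]) (auto simp: indicator_def)
  have [simp]: "integrable M (\<lambda>\<omega>. of_real (w \<omega>) * iexp (t * X \<omega>))" for t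
    by (rule integrable_const_bound[where B = C]) (auto simp: norm_mult w_le simp del: of_real_mult)
  have [simp]: "integrable M (\<lambda>\<omega>. iexp (t * X \<omega>))" for t
    by (rule integrable_const_bound[where B = 1]) (auto simp del: of_real_mult)
  have [simp]: "integrable M (\<lambda>\<omega>. indicator B (X \<omega>) :: real)"
    by (rule integrable_const_bound[where B = 1]) auto
  have "expectation (\<lambda>\<omega>. (w \<omega> + C) * indicator B (X \<omega>)) =
    expectation (\<lambda>\<omega>. w \<omega> + C) * expectation (\<lambda>\<omega>. indicator B (X \<omega>))"
  proof (rule expectation_mult_indicator_if_iexp_nonneg[where C = "2 * C"])
    show "0 \<le> w \<omega> + C" "w \<omega> + C \<le> 2 * C" for \<omega>
      using w_le[of \<omega>] by auto
    show "expectation (\<lambda>\<omega>. of_real (w \<omega> + C) * iexp (t * X \<omega>)) =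
      of_real (expectation (\<lambda>\<omega>. w \<omega> + C)) * expectation (\<lambda>\<omega>. iexp (t * X \<omega>))" for t
      using eq[of t] by (simp add: ring_distribs prob_space del: of_real_mult)
  qed measurable
  then show ?thesis
    by (simp add: ring_distribs prob_space)
qed

text \<open>Reduction to the real and imaginary parts of \<open>W\<close>. Each of them is a
  combination of \<open>W\<close> and its conjugate, so the hypothesis is first transferred to the
  conjugate.\<close>

lemma (in prob_space) expectation_mult_indicator_if_iexp:
  fixes W :: "'a \<Rightarrow> complex" and X :: "'a \<Rightarrow> real"
  assumes X [measurable]: "random_variable borel X" and W [measurable]: "W \<in> borel_measurable M"
    and W_le: "\<And>\<omega>. norm (W \<omega>) \<le> C"
    and eq: "\<And>t. expectation (\<lambda>\<omega>. W \<omega> * iexp (t * X \<omega>)) =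
      expectation W * expectation (\<lambda>\<omega>. iexp (t * X \<omega>))"
    and B [measurable]: "B \<in> sets borel"
  shows "expectation (\<lambda>\<omega>. W \<omega> * of_real (indicator B (X \<omega>))) =
    expectation W * of_real (expectation (\<lambda>\<omega>. indicator B (X \<omega>)))"
proof -
  have int_W [simp]: "integrable M W"
    by (rule integrable_const_bound[where B = C]) (auto simp: W_le)
  have int_We [simp]: "integrable M (\<lambda>\<omega>. W \<omega> * iexp (t * X \<omega>))" for t
    by (rule integrable_const_bound[where B = C]) (auto simp: norm_mult W_le simp del: of_real_mult)
  have [measurable]: "(\<lambda>\<omega>. cnj (W \<omega>)) \<in> borel_measurable M"
    by (rule measurable_compose[OF W borel_measurable_continuous_onI]) (intro continuous_intros)
  have int_cWe [simp]: "integrable M (\<lambda>\<omega>. cnj (W \<omega>) * iexp (t * X \<omega>))" for t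
    by (rule integrable_const_bound[where B = C]) (auto simp: norm_mult W_le simp del: of_real_mult)
  have [simp]: "integrable M (\<lambda>\<omega>. W \<omega> * of_real (indicator B (X \<omega>)))"
    using W_le order_trans[OF norm_ge_zero W_le]
    by (intro integrable_const_bound[where B = C]) (auto simp: indicator_def)
  have cnj_iexp: "cnj (iexp x) = iexp (- x)" for x
    by (simp add: exp_cnj)
  \<comment> \<open>This is the conjugate of \<open>eq\<close> at the frequency \<open>- t\<close>;
    conjugation flips the sign back.\<close>
  have eq_cnj: "expectation (\<lambda>\<omega>. cnj (W \<omega>) * iexp (t * X \<omega>)) =
      cnj (expectation W) * expectation (\<lambda>\<omega>. iexp (t * X \<omega>))" for t
  proof -
    have "expectation (\<lambda>\<omega>. cnj (W \<omega>) * iexp (t * X \<omega>)) =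
      expectation (\<lambda>\<omega>. cnj (W \<omega> * iexp (- t * X \<omega>)))"
      unfolding complex_cnj_mult cnj_iexp by simp
    also have "\<dots> = cnj (expectation (\<lambda>\<omega>. W \<omega> * iexp (- t * X \<omega>)))"
      by (rule Bochner_Integration.integral_cnj)
    also have "\<dots> = cnj (expectation W) * expectation (\<lambda>\<omega>. cnj (iexp (- t * X \<omega>)))"
      by (simp only: eq complex_cnj_mult Bochner_Integration.integral_cnj)
    finally show ?thesis
      unfolding cnj_iexp by simp
  qed
  have Re_eq: "of_real (Re z) = (z + cnj z) / 2" and Im_eq: "of_real (Im z) = (z - cnj z) / (2 * \<i>)" for z
    by (auto simp: complex_eq_iff)
  have Re: "expectation (\<lambda>\<omega>. Re (W \<omega>) * indicator B (X \<omega>)) =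
    expectation (\<lambda>\<omega>. Re (W \<omega>)) * expectation (\<lambda>\<omega>. indicator B (X \<omega>))"
  proof (rule expectation_mult_indicator_if_iexp_real[where C = C])
    show "\<bar>Re (W \<omega>)\<bar> \<le> C" for \<omega>
      using abs_Re_le_cmod W_le order_trans by blast
    fix t
    have "expectation (\<lambda>\<omega>. of_real (Re (W \<omega>)) * iexp (t * X \<omega>)) =
      expectation (\<lambda>\<omega>. (W \<omega> * iexp (t * X \<omega>) + cnj (W \<omega>) * iexp (t * X \<omega>)) / 2)"
      unfolding Re_eq by (simp add: ring_distribs add_divide_distrib)
    also have "\<dots> = (expectation (\<lambda>\<omega>. W \<omega> * iexp (t * X \<omega>)) + expectation (\<lambda>\<omega>. cnj (W \<omega>) * iexp (t * X \<omega>))) / 2"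
      by (simp only: integral_divide_zero Bochner_Integration.integral_add[OF int_We int_cWe])
    also have "\<dots> = of_real (expectation (\<lambda>\<omega>. Re (W \<omega>))) * expectation (\<lambda>\<omega>. iexp (t * X \<omega>))"
      unfolding eq eq_cnj by (simp only: integral_Re[OF int_W] Re_eq) (simp only: ring_distribs add_divide_distrib times_divide_eq_left)
    finally show "expectation (\<lambda>\<omega>. of_real (Re (W \<omega>)) * iexp (t * X \<omega>)) =
      of_real (expectation (\<lambda>\<omega>. Re (W \<omega>))) * expectation (\<lambda>\<omega>. iexp (t * X \<omega>))" .
  qed auto
  have Im: "expectation (\<lambda>\<omega>. Im (W \<omega>) * indicator B (X \<omega>)) =
    expectation (\<lambda>\<omega>. Im (W \<omega>)) * expectation (\<lambda>\<omega>. indicator B (X \<omega>))"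
  proof (rule expectation_mult_indicator_if_iexp_real[where C = C])
    show "\<bar>Im (W \<omega>)\<bar> \<le> C" for \<omega>
      using abs_Im_le_cmod W_le order_trans by blast
    fix t
    have "expectation (\<lambda>\<omega>. of_real (Im (W \<omega>)) * iexp (t * X \<omega>)) =
      expectation (\<lambda>\<omega>. (W \<omega> * iexp (t * X \<omega>) - cnj (W \<omega>) * iexp (t * X \<omega>)) / (2 * \<i>))"
      unfolding Im_eq by (simp only: ring_distribs diff_divide_distrib times_divide_eq_left)
    also have "\<dots> = (expectation (\<lambda>\<omega>. W \<omega> * iexp (t * X \<omega>)) - expectation (\<lambda>\<omega>. cnj (W \<omega>) * iexp (t * X \<omega>))) / (2 * \<i>)"
      by (simp only: integral_divide_zero Bochner_Integration.integral_diff[OF int_We int_cWe])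
    also have "\<dots> = of_real (expectation (\<lambda>\<omega>. Im (W \<omega>))) * expectation (\<lambda>\<omega>. iexp (t * X \<omega>))"
      unfolding eq eq_cnj by (simp only: integral_Im[OF int_W] Im_eq) (simp only: ring_distribs diff_divide_distrib times_divide_eq_left)
    finally show "expectation (\<lambda>\<omega>. of_real (Im (W \<omega>)) * iexp (t * X \<omega>)) =
      of_real (expectation (\<lambda>\<omega>. Im (W \<omega>))) * expectation (\<lambda>\<omega>. iexp (t * X \<omega>))" .
  qed auto
  show ?thesis
    using Re Im by (simp add: complex_eq_iff integral_Re[symmetric] integral_Im[symmetric] del: integral_Re integral_Im)
qed

text \<open>The exponentials are traded for indicators one coordinate at a time; the remaining factors
  serve as the bounded weight \<open>W\<close>.\<close>

lemma (in prob_space) expectation_prod_indicator_iexp: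
  fixes X :: "'i \<Rightarrow> 'a \<Rightarrow> real"
  assumes J: "finite J" and X: "\<And>x. x \<in> J \<Longrightarrow> random_variable borel (X x)"
    and char: "\<And>t. expectation (\<lambda>\<omega>. \<Prod>x\<in>J. iexp (t x * X x \<omega>)) =
      (\<Prod>x\<in>J. expectation (\<lambda>\<omega>. iexp (t x * X x \<omega>)))"
    and B: "\<And>x. x \<in> J \<Longrightarrow> B x \<in> sets borel" and "A \<subseteq> J"
  defines "g \<equiv> \<lambda>A t x \<omega>. if x \<in> A then of_real (indicator (B x) (X x \<omega>)) else iexp (t x * X x \<omega>)"
  shows "expectation (\<lambda>\<omega>. \<Prod>x\<in>J. g A t x \<omega>) = (\<Prod>x\<in>J. expectation (g A t x))"
  using finite_subset[OF \<open>A \<subseteq> J\<close> J] \<open>A \<subseteq> J\<close>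
proof (induction A arbitrary: t rule: finite_induct)
  case empty
  then show ?case using char[of t] by (simp add: g_def)
next
  case (insert y A)
  note y = \<open>y \<notin> A\<close>
  have yJ: "y \<in> J" using insert by auto
  have X_y: "random_variable borel (X y)" using X yJ .
  have B_y: "B y \<in> sets borel" using B yJ .
  define W where "W = (\<lambda>\<omega>. \<Prod>x\<in>J - {y}. g A t x \<omega>)"
  have g_meas: "g A t x \<in> borel_measurable M" if "x \<in> J" for A t x
    using X[OF that, measurable] B[OF that, measurable] unfolding g_def by (cases "x \<in> A") auto
  have W_meas: "W \<in> borel_measurable M"
    unfolding W_def by (rule borel_measurable_prod) (use g_meas in auto)
  have g_le: "norm (g A t x \<omega>) \<le> 1" for A t x \<omega>
    by (auto simp: g_def indicator_def simp del: of_real_mult)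
  have W_le: "norm (W \<omega>) \<le> 1" for \<omega>
    unfolding W_def prod_norm[symmetric] by (rule prod_le_1) (use g_le in auto)
  have g_upd: "g A (t(y := u)) x = g A t x" if "x \<noteq> y" for u x
    using that by (auto simp: g_def fun_eq_iff)
  have g_y: "g A (t(y := u)) y = (\<lambda>\<omega>. iexp (u * X y \<omega>))" for u
    using y by (simp add: g_def)
  \<comment> \<open>The induction is over arbitrary \<open>t\<close>, so the frequency at
    \<open>y\<close> can be set to any \<open>u\<close> while \<open>W\<close>, which omits
    \<open>y\<close>, stays the same. This supplies the condition for all frequencies that the
    exchange at \<open>y\<close> requires.\<close>
  have IH: "expectation (\<lambda>\<omega>. W \<omega> * iexp (u * X y \<omega>)) =
    (\<Prod>x\<in>J - {y}. expectation (g A t x)) * expectation (\<lambda>\<omega>. iexp (u * X y \<omega>))" for u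
  proof -
    have "expectation (\<lambda>\<omega>. \<Prod>x\<in>J. g A (t(y := u)) x \<omega>) = (\<Prod>x\<in>J. expectation (g A (t(y := u)) x))"
      using insert by auto
    moreover have "(\<Prod>x\<in>J. g A (t(y := u)) x \<omega>) = W \<omega> * iexp (u * X y \<omega>)" for \<omega>
      unfolding W_def prod.remove[OF J yJ] g_y
      by (subst mult.commute) (auto simp: g_upd intro!: prod.cong)
    moreover have "(\<Prod>x\<in>J. expectation (g A (t(y := u)) x)) =
      (\<Prod>x\<in>J - {y}. expectation (g A t x)) * expectation (\<lambda>\<omega>. iexp (u * X y \<omega>))"
      unfolding prod.remove[OF J yJ] g_y
      by (subst mult.commute) (auto simp: g_upd intro!: prod.cong)
    ultimately show ?thesis by simp
  qed
  \<comment> \<open>At frequency 0 the exponential is 1, which identifies the remaining product as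
    the mean of \<open>W\<close>.\<close>
  from IH[of 0] have EW: "expectation W = (\<Prod>x\<in>J - {y}. expectation (g A t x))"
    by (simp add: prob_space)
  have ins: "g (insert y A) t x = g A t x" if "x \<noteq> y" for x
    using that by (auto simp: g_def)
  have ins_y: "g (insert y A) t y = (\<lambda>\<omega>. of_real (indicator (B y) (X y \<omega>)))"
    by (simp add: g_def)
  have "(\<Prod>x\<in>J. g (insert y A) t x \<omega>) = W \<omega> * of_real (indicator (B y) (X y \<omega>))" for \<omega>
    unfolding W_def prod.remove[OF J yJ] ins_y by (simp add: ins)
  then have "expectation (\<lambda>\<omega>. \<Prod>x\<in>J. g (insert y A) t x \<omega>) =
    expectation (\<lambda>\<omega>. W \<omega> * of_real (indicator (B y) (X y \<omega>)))"
    by simp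
  also have "\<dots> = expectation W * of_real (expectation (\<lambda>\<omega>. indicator (B y) (X y \<omega>)))"
    by (rule expectation_mult_indicator_if_iexp[OF X_y W_meas W_le _ B_y]) (simp only: IH EW)
  also have "\<dots> = (\<Prod>x\<in>J. expectation (g (insert y A) t x))"
    unfolding prod.remove[OF J yJ] ins_y EW by (simp add: ins)
  finally show ?case .
qed

text \<open>Once every coordinate of \<open>J\<close> has been exchanged, the expectation of a
  product of indicators is the probability of an intersection of preimages, and the factorisation is
  the product formula for Borel sets.\<close>

lemma (in prob_space) indep_vars_if_char_prod:
  fixes X :: "'i \<Rightarrow> 'a \<Rightarrow> real"
  assumes J: "finite J" and X: "\<And>x. x \<in> J \<Longrightarrow> random_variable borel (X x)"
    and char: "\<And>t. char (distr M borel (\<lambda>\<omega>. \<Sum>x\<in>J. t x * X x \<omega>)) 1 =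
      (\<Prod>x\<in>J. char (distr M borel (X x)) (t x))"
  shows "indep_vars (\<lambda>_. borel) X J"
proof (cases "J = {}")
  case True
  then show ?thesis by (simp add: indep_vars_def indep_sets_def)
next
  case False
  have char_X: "char (distr M borel (X x)) u = expectation (\<lambda>\<omega>. iexp (u * X x \<omega>))" if "x \<in> J" for x u
    using X[OF that, measurable] by (simp add: char_def integral_distr)
  have [measurable]: "(\<lambda>\<omega>. \<Sum>x\<in>J. t x * X x \<omega>) \<in> borel_measurable M" for t
    using X by (intro borel_measurable_sum borel_measurable_times) auto
  have char': "expectation (\<lambda>\<omega>. \<Prod>x\<in>J. iexp (t x * X x \<omega>)) =
      (\<Prod>x\<in>J. expectation (\<lambda>\<omega>. iexp (t x * X x \<omega>)))" for t
    using char[of t] J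
    by (simp add: char_def[of _ 1] integral_distr char_X sum_distrib_left exp_sum cong: prod.cong)
  have prob_eq: "prob (\<Inter>x\<in>J. X x -` B x \<inter> space M) = (\<Prod>x\<in>J. prob (X x -` B x \<inter> space M))"
    if B: "\<And>x. x \<in> J \<Longrightarrow> B x \<in> sets borel" for B
  proof -
    have ind: "expectation (\<lambda>\<omega>. of_real (indicator (B x) (X x \<omega>)) :: complex) = of_real (prob (X x -` B x \<inter> space M))"
      if "x \<in> J" for x
    proof -
      have "expectation (\<lambda>\<omega>. of_real (indicator (B x) (X x \<omega>)) :: complex) =
        of_real (expectation (\<lambda>\<omega>. indicator (B x) (X x \<omega>)))"
        by simp
      also have "expectation (\<lambda>\<omega>. indicator (B x) (X x \<omega>)) = expectation (indicator (X x -` B x \<inter> space M) :: _ \<Rightarrow> real)"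
        by (rule Bochner_Integration.integral_cong) (auto simp: indicator_def)
      finally show ?thesis by simp
    qed
    have "of_real (prob (\<Inter>x\<in>J. X x -` B x \<inter> space M)) =
      (of_real (expectation (indicator (\<Inter>x\<in>J. X x -` B x \<inter> space M))) :: complex)"
      using False by (subst Bochner_Integration.integral_indicator) (auto intro!: arg_cong[where f = prob])
    also have "\<dots> = expectation (\<lambda>\<omega>. of_real (indicator (\<Inter>x\<in>J. X x -` B x \<inter> space M) \<omega>))"
      by simp
    also have "\<dots> = expectation (\<lambda>\<omega>. \<Prod>x\<in>J. of_real (indicator (B x) (X x \<omega>)))"
      using J False by (intro Bochner_Integration.integral_cong)
        (auto simp: indicator_def prod_zero_iff split: if_splits)
    also have "\<dots> = (\<Prod>x\<in>J. expectation (\<lambda>\<omega>. of_real (indicator (B x) (X x \<omega>))))"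
      using expectation_prod_indicator_iexp[OF J X char' B order_refl] by (simp cong: prod.cong)
    also have "\<dots> = of_real (\<Prod>x\<in>J. prob (X x -` B x \<inter> space M))"
      by (simp only: ind of_real_prod cong: prod.cong)
    finally show ?thesis
      by (simp only: of_real_eq_iff)
  qed
  \<comment> \<open>The Borel sets serve as their own generator, stable under intersection and
    containing the whole line. Hence intersections over all of the nonempty \<open>J\<close>
    suffice; smaller subfamilies arise by choosing the whole line for the other coordinates.\<close>
  show ?thesis
    by (subst indep_vars_finite[OF False J, where E = "\<lambda>_. sets borel"])
      (use X prob_eq in \<open>auto simp: Pi_iff sets.Int_stable sets.sigma_sets_eq[of borel, simplified]\<close>)
qed


section \<open>Gaussian families under maps with orthonormal columns\<close>

lemma std_gaussian_iff_char:
  assumes "prob_space P" and X: "X \<in> borel_measurable P"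
  shows "std_gaussian P X \<longleftrightarrow> (\<forall>t. char (distr P borel X) t = of_real (exp (- t\<^sup>2 / 2)))"
proof -
  interpret prob_space P by fact
  have eq: "distr P lborel X = distr P borel X"
    by (rule distr_cong) auto
  have "std_gaussian P X \<longleftrightarrow> distr P borel X = std_normal_distribution"
    using X by (simp add: std_gaussian_def distributed_def eq)
  also have "\<dots> \<longleftrightarrow> char (distr P borel X) = char std_normal_distribution"
    using Levy_uniqueness[OF real_distribution_distr[OF X] real_dist_normal_dist] by auto
  finally show ?thesis
    by (simp add: char_std_normal_distribution fun_eq_iff)
qed

lemma std_gaussian_measurable: "std_gaussian P X \<Longrightarrow> X \<in> borel_measurable P"
  by (simp add: std_gaussian_def distributed_def)

lemma (in prob_space) char_distr_scale:
  assumes [measurable]: "random_variable borel X"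
  shows "char (distr M borel (\<lambda>\<omega>. a * X \<omega>)) t = char (distr M borel X) (a * t)"
  by (simp add: char_def integral_distr mult_ac)

text \<open>Two layers of independence are used. The block sums \<open>Y s\<close> are measurable
  functions of independent sub-vectors. Within a block, only the at most k indices with nonzero
  coefficient matter, and k-wise independence makes those entries mutually independent.\<close>

lemma (in prob_space) char_distr_gaussian_sum:
  fixes V :: "'i \<Rightarrow> 'a \<Rightarrow> real"
  assumes S: "finite S" and I: "\<And>s. s \<in> S \<Longrightarrow> finite (I s)"
    and indep: "indep_vars (\<lambda>s. PiM (I s) (\<lambda>_. borel)) (\<lambda>s \<omega>. \<lambda>i\<in>I s. V i \<omega>) S"
    and gauss: "\<And>s i. s \<in> S \<Longrightarrow> i \<in> I s \<Longrightarrow> std_gaussian M (V i)"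
    and kwise: "\<And>s. s \<in> S \<Longrightarrow> kwise_indep M k V (I s)"
    and a: "\<And>s. s \<in> S \<Longrightarrow> card {i \<in> I s. a i \<noteq> 0} \<le> k"
  shows "char (distr M borel (\<lambda>\<omega>. \<Sum>s\<in>S. \<Sum>i\<in>I s. a i * V i \<omega>)) 1 =
    of_real (exp (- (\<Sum>s\<in>S. \<Sum>i\<in>I s. (a i)\<^sup>2) / 2))"
proof -
  define Y where "Y s \<omega> = (\<Sum>i\<in>I s. a i * V i \<omega>)" for s \<omega>
  have "indep_vars (\<lambda>_. borel) (\<lambda>s \<omega>. (\<lambda>g. \<Sum>i\<in>I s. a i * g i) (\<lambda>i\<in>I s. V i \<omega>)) S"
    by (rule indep_vars_compose2[OF indep]) measurable
  moreover have "(\<lambda>g. \<Sum>i\<in>I s. a i * g i) (\<lambda>i\<in>I s. V i \<omega>) = Y s \<omega>" for s \<omega>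
    by (simp add: Y_def cong: sum.cong)
  ultimately have indep_Y: "indep_vars (\<lambda>_. borel) Y S"
    by simp
  have char_Y: "char (distr M borel (Y s)) 1 = (\<Prod>i\<in>I s. of_real (exp (- (a i)\<^sup>2 / 2)))" if s: "s \<in> S" for s
  proof -
    \<comment> \<open>The block \<open>I s\<close> may have more than k members, so the zero
      coefficients are dropped before independence is invoked. They return at the end as factors
      \<open>exp 0 = 1\<close>.\<close>
    define L where "L = {i \<in> I s. a i \<noteq> 0}"
    have L: "L \<subseteq> I s" "finite L" "card L \<le> k"
      using I[OF s] a[OF s] by (auto simp: L_def)
    have "Y s = (\<lambda>\<omega>. \<Sum>i\<in>L. a i * V i \<omega>)"
      unfolding Y_def by (intro ext sum.mono_neutral_right) (use I[OF s] in \<open>auto simp: L_def\<close>)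
    moreover have "indep_vars (\<lambda>_. borel) V L"
      using kwise[OF s] L unfolding kwise_indep_def by blast
    then have "indep_vars (\<lambda>_. borel) (\<lambda>i \<omega>. a i * V i \<omega>) L"
      by (rule indep_vars_compose2) simp
    ultimately have "char (distr M borel (Y s)) 1 = (\<Prod>i\<in>L. char (distr M borel (\<lambda>\<omega>. a i * V i \<omega>)) 1)"
      by (simp add: char_distr_sum)
    also have "\<dots> = (\<Prod>i\<in>L. of_real (exp (- (a i)\<^sup>2 / 2)))"
    proof (rule prod.cong[OF refl])
      fix i assume "i \<in> L"
      then have "std_gaussian M (V i)" using L gauss[OF s] by auto
      from this std_gaussian_measurable[OF this]
      show "char (distr M borel (\<lambda>\<omega>. a i * V i \<omega>)) 1 = of_real (exp (- (a i)\<^sup>2 / 2))"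
        by (simp add: char_distr_scale std_gaussian_iff_char[OF prob_space_axioms])
    qed
    also have "\<dots> = (\<Prod>i\<in>I s. of_real (exp (- (a i)\<^sup>2 / 2)))"
      by (intro prod.mono_neutral_left) (use I[OF s] in \<open>auto simp: L_def\<close>)
    finally show ?thesis .
  qed
  have "char (distr M borel (\<lambda>\<omega>. \<Sum>s\<in>S. Y s \<omega>)) 1 = (\<Prod>s\<in>S. \<Prod>i\<in>I s. of_real (exp (- (a i)\<^sup>2 / 2)))"
    using char_distr_sum[OF indep_Y, of 1] char_Y by simp
  also have "\<dots> = of_real (\<Prod>s\<in>S. \<Prod>i\<in>I s. exp (- (a i)\<^sup>2 / 2))"
    by simp
  also have "(\<Prod>s\<in>S. \<Prod>i\<in>I s. exp (- (a i)\<^sup>2 / 2)) = exp (\<Sum>s\<in>S. \<Sum>i\<in>I s. - (a i)\<^sup>2 / 2)"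
    using S I by (simp add: exp_sum cong: prod.cong)
  also have "(\<Sum>s\<in>S. \<Sum>i\<in>I s. - (a i)\<^sup>2 / 2) = - (\<Sum>s\<in>S. \<Sum>i\<in>I s. (a i)\<^sup>2) / 2"
    by (simp only: sum_divide_distrib[symmetric] sum_negf)
  finally show ?thesis
    unfolding Y_def .
qed

text \<open>The probabilistic core, freed from Haar vectors: \<open>c\<close> is the matrix,
  \<open>i\<close> a row, \<open>x\<close> a column and \<open>s\<close> a group of rows. The
  condition \<open>single\<close> keeps the number of rows of a group met by k columns at most k;
  \<open>orth\<close> gives the combined characteristic function its product form.\<close>

lemma (in prob_space) kwise_gaussian_orthonormal_image:
  fixes V :: "'i \<Rightarrow> 'a \<Rightarrow> real" and Z :: "'j \<Rightarrow> 'a \<Rightarrow> real"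
  assumes S: "finite S" and I: "\<And>s. s \<in> S \<Longrightarrow> finite (I s)"
    and indep: "indep_vars (\<lambda>s. PiM (I s) (\<lambda>_. borel)) (\<lambda>s \<omega>. \<lambda>i\<in>I s. V i \<omega>) S"
    and gauss: "\<And>s i. s \<in> S \<Longrightarrow> i \<in> I s \<Longrightarrow> std_gaussian M (V i)"
    and kwise: "\<And>s. s \<in> S \<Longrightarrow> kwise_indep M k V (I s)"
    and k: "k \<ge> 1"
    and Z: "\<And>x \<omega>. x \<in> K \<Longrightarrow> \<omega> \<in> space M \<Longrightarrow> Z x \<omega> = (\<Sum>s\<in>S. \<Sum>i\<in>I s. c i x * V i \<omega>)"
    and single: "\<And>s x i i'. s \<in> S \<Longrightarrow> x \<in> K \<Longrightarrow> i \<in> I s \<Longrightarrow> i' \<in> I s \<Longrightarrow>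
      c i x \<noteq> 0 \<Longrightarrow> c i' x \<noteq> 0 \<Longrightarrow> i = i'"
    and orth: "\<And>x y. x \<in> K \<Longrightarrow> y \<in> K \<Longrightarrow> (\<Sum>s\<in>S. \<Sum>i\<in>I s. c i x * c i y) = of_bool (x = y)"
  shows "(\<forall>x\<in>K. std_gaussian M (Z x)) \<and> kwise_indep M k Z K"
proof -
  have Z_meas: "Z x \<in> borel_measurable M" if x: "x \<in> K" for x
  proof -
    have "(\<lambda>\<omega>. \<Sum>s\<in>S. \<Sum>i\<in>I s. c i x * V i \<omega>) \<in> borel_measurable M"
      by (intro borel_measurable_sum borel_measurable_times borel_measurable_const)
        (auto intro: std_gaussian_measurable gauss)
    then show ?thesis
      by (rule measurable_cong[THEN iffD2, rotated]) (rule Z[OF x])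
  qed
  have char_lin: "char (distr M borel (\<lambda>\<omega>. \<Sum>x\<in>J. t x * Z x \<omega>)) 1 = of_real (exp (- (\<Sum>x\<in>J. (t x)\<^sup>2) / 2))"
    if J: "J \<subseteq> K" "finite J" "card J \<le> k" for J t
  proof -
    define a where "a i = (\<Sum>x\<in>J. t x * c i x)" for i
    have card: "card {i \<in> I s. a i \<noteq> 0} \<le> k" if s: "s \<in> S" for s
    proof -
      \<comment> \<open>Each column is sent to its only nonzero row in the group. For a column
        without such a row the choice is arbitrary, which is harmless because only an inclusion is
        claimed.\<close>
      have "{i \<in> I s. a i \<noteq> 0} \<subseteq> (\<lambda>x. SOME i. i \<in> I s \<and> c i x \<noteq> 0) ` J"
      proof
        fix i assume i: "i \<in> {i \<in> I s. a i \<noteq> 0}"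
        then have "(\<Sum>x\<in>J. t x * c i x) \<noteq> 0"
          by (simp add: a_def)
        then obtain x where x: "x \<in> J" "t x * c i x \<noteq> 0"
          by (rule sum.not_neutral_contains_not_neutral)
        then have "(SOME i. i \<in> I s \<and> c i x \<noteq> 0) = i"
          using i s J single by (intro some_equality) auto
        then show "i \<in> (\<lambda>x. SOME i. i \<in> I s \<and> c i x \<noteq> 0) ` J"
          using x(1) by (intro image_eqI[where x = x]) simp_all
      qed
      then have "card {i \<in> I s. a i \<noteq> 0} \<le> card J"
        using J(2) by (rule surj_card_le[rotated])
      with J(3) show ?thesis by simp
    qed
    have "(\<Sum>x\<in>J. t x * Z x \<omega>) = (\<Sum>s\<in>S. \<Sum>i\<in>I s. a i * V i \<omega>)" if "\<omega> \<in> space M" for \<omega>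
    proof -
      have "(\<Sum>x\<in>J. t x * Z x \<omega>) = (\<Sum>x\<in>J. \<Sum>s\<in>S. \<Sum>i\<in>I s. t x * c i x * V i \<omega>)"
        using J that by (intro sum.cong) (auto simp: Z sum_distrib_left mult.assoc)
      also have "\<dots> = (\<Sum>s\<in>S. \<Sum>x\<in>J. \<Sum>i\<in>I s. t x * c i x * V i \<omega>)"
        by (rule sum.swap)
      also have "\<dots> = (\<Sum>s\<in>S. \<Sum>i\<in>I s. \<Sum>x\<in>J. t x * c i x * V i \<omega>)"
        by (intro sum.cong refl sum.swap)
      finally show ?thesis
        by (simp add: a_def sum_distrib_right)
    qed
    then have "distr M borel (\<lambda>\<omega>. \<Sum>x\<in>J. t x * Z x \<omega>) = distr M borel (\<lambda>\<omega>. \<Sum>s\<in>S. \<Sum>i\<in>I s. a i * V i \<omega>)"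
      by (intro distr_cong) auto
    moreover have "(\<Sum>s\<in>S. \<Sum>i\<in>I s. (a i)\<^sup>2) = (\<Sum>x\<in>J. (t x)\<^sup>2)"
    proof -
      \<comment> \<open>The square is expanded and the sums over rows are moved inside, where they
        form the inner product of two columns and \<open>orth\<close> applies.\<close>
      have "(\<Sum>s\<in>S. \<Sum>i\<in>I s. (a i)\<^sup>2) = (\<Sum>s\<in>S. \<Sum>i\<in>I s. \<Sum>x\<in>J. \<Sum>y\<in>J. t x * t y * (c i x * c i y))"
        unfolding a_def power2_eq_square sum_product by (simp only: mult_ac)
      also have "\<dots> = (\<Sum>s\<in>S. \<Sum>x\<in>J. \<Sum>i\<in>I s. \<Sum>y\<in>J. t x * t y * (c i x * c i y))"
        by (intro sum.cong refl sum.swap)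
      also have "\<dots> = (\<Sum>s\<in>S. \<Sum>x\<in>J. \<Sum>y\<in>J. \<Sum>i\<in>I s. t x * t y * (c i x * c i y))"
        by (intro sum.cong refl sum.swap)
      also have "\<dots> = (\<Sum>x\<in>J. \<Sum>s\<in>S. \<Sum>y\<in>J. \<Sum>i\<in>I s. t x * t y * (c i x * c i y))"
        by (rule sum.swap)
      also have "\<dots> = (\<Sum>x\<in>J. \<Sum>y\<in>J. \<Sum>s\<in>S. \<Sum>i\<in>I s. t x * t y * (c i x * c i y))"
        by (intro sum.cong refl sum.swap)
      also have "\<dots> = (\<Sum>x\<in>J. \<Sum>y\<in>J. t x * t y * of_bool (x = y))"
        unfolding sum_distrib_left[symmetric]
        by (intro sum.cong refl arg_cong2[where f = "(*)"] orth) (use J(1) in auto)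
      also have "\<dots> = (\<Sum>x\<in>J. \<Sum>y\<in>J. if x = y then (t x)\<^sup>2 else 0)"
        by (intro sum.cong refl) (auto simp: power2_eq_square)
      also have "\<dots> = (\<Sum>x\<in>J. (t x)\<^sup>2)"
        using J(2) by simp
      finally show ?thesis .
    qed
    ultimately show ?thesis
      using char_distr_gaussian_sum[OF S I indep gauss kwise card] by simp
  qed
  \<comment> \<open>A single entry is the combination over \<open>{x}\<close>, which
    \<open>k \<ge> 1\<close> admits.\<close>
  have gauss_Z: "std_gaussian M (Z x)" if x: "x \<in> K" for x
    unfolding std_gaussian_iff_char[OF prob_space_axioms Z_meas[OF x]]
    using char_lin[of "{x}" "\<lambda>_. t" for t] x k by (simp add: char_distr_scale[OF Z_meas[OF x]])
  have "indep_vars (\<lambda>_. borel) Z J" if J: "J \<subseteq> K" "finite J" "card J \<le> k" for J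
  proof (rule indep_vars_if_char_prod[OF J(2)])
    show Z_J: "random_variable borel (Z x)" if "x \<in> J" for x
      using that J Z_meas by auto
    fix t :: "'j \<Rightarrow> real"
    have "char (distr M borel (\<lambda>\<omega>. \<Sum>x\<in>J. t x * Z x \<omega>)) 1 = of_real (exp (\<Sum>x\<in>J. - (t x)\<^sup>2 / 2))"
      unfolding char_lin[OF J] by (simp only: sum_divide_distrib[symmetric] sum_negf)
    also have "\<dots> = (\<Prod>x\<in>J. of_real (exp (- (t x)\<^sup>2 / 2)))"
      using J(2) by (simp add: exp_sum)
    also have "\<dots> = (\<Prod>x\<in>J. char (distr M borel (Z x)) (t x))"
    proof (rule prod.cong[OF refl])
      fix x assume "x \<in> J"
      then show "of_real (exp (- (t x)\<^sup>2 / 2)) = char (distr M borel (Z x)) (t x)"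
        using gauss_Z[of x] J Z_J by (auto simp: std_gaussian_iff_char[OF prob_space_axioms])
    qed
    finally show "char (distr M borel (\<lambda>\<omega>. \<Sum>x\<in>J. t x * Z x \<omega>)) 1 = (\<Prod>x\<in>J. char (distr M borel (Z x)) (t x))" .
  qed
  with gauss_Z show ?thesis
    by (auto simp: kwise_indep_def)
qed

section \<open>The Haar matrix\<close>

lemma haar_labels_1: "haar_labels (2 ^ 0) = [(-1, 0)]"
  by (simp add: haar_labels_def)

text \<open>The labels depend on the dimension only through the number of scales, and dictionary
  order puts the finest scale last. Thus \<open>haar_labels (2 ^ m)\<close> also lists the coarse
  rows of any larger Haar matrix, which permits induction on the scale in a fixed dimension.\<close>

lemma haar_labels_Suc: "haar_labels (2 ^ Suc n) = haar_labels (2 ^ n) @ map (Pair (int n)) [0..<2 ^ n]"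
proof -
  have log: "log 2 (real (2 ^ m)) = real m" for m
    by (simp add: log_nat_power)
  have "[-1..int (Suc n) - 1] = [-1..int n - 1] @ [int n]"
    by (simp add: upto_rec2)
  moreover have "[0..<2 ^ nat (max 0 (int n))] = [0..<2 ^ n]"
    by (simp add: max_def)
  ultimately show ?thesis
    unfolding haar_labels_def log by (simp add: comp_def)
qed

lemma length_haar_labels: "length (haar_labels (2 ^ n)) = 2 ^ n"
  by (induction n) (simp add: haar_labels_1[simplified], simp only: haar_labels_Suc, simp)

lemma haar_labels_bounds: "(m, j) \<in> set (haar_labels (2 ^ n)) \<Longrightarrow> -1 \<le> m \<and> m < int n \<and> (m = -1 \<longrightarrow> j = 0)"
proof (induction n)
  case 0
  then show ?case by (simp add: haar_labels_1[simplified])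
next
  case (Suc n)
  then show ?case unfolding haar_labels_Suc by auto
qed

lemma distinct_haar_labels: "distinct (haar_labels (2 ^ n))"
proof (induction n)
  case 0
  then show ?case by (simp add: haar_labels_1[simplified])
next
  case (Suc n)
  then show ?case
    unfolding haar_labels_Suc using haar_labels_bounds by (fastforce simp: distinct_map inj_on_def)
qed

lemma haar_vec_scaling: "x < \<Delta> \<Longrightarrow> haar_vec \<Delta> (-1) j $ x = 1 / sqrt (real \<Delta>)"
  by (simp add: haar_vec_def)

text \<open>Interval membership becomes integer division: the quotient of \<open>x\<close> by the
  interval length is the number of the interval containing \<open>x\<close>, and the parity of the
  quotient by half that length tells the half. In particular \<open>x\<close> determines the only
  \<open>j\<close> with a nonzero value at this scale.\<close>

lemma haar_vec_eq:
  assumes "m < n" and x: "x < 2 ^ n"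
  shows "haar_vec (2 ^ n) (int m) j $ x =
    (if x div 2 ^ (n - m) = j
     then (if even (x div 2 ^ (n - Suc m)) then 1 else -1) * sqrt (2 ^ m / 2 ^ n) else 0)"
proof -
  \<comment> \<open>Half the length of the supporting interval.\<close>
  define u :: nat where "u = 2 ^ (n - Suc m)"
  have u: "u > 0" by (simp add: u_def)
  have w: "2 ^ (n - m) = 2 * u"
    using \<open>m < n\<close> by (simp add: u_def Suc_diff_Suc flip: power_Suc)
  have div: "2 ^ n div 2 ^ m = 2 * u"
    using \<open>m < n\<close> w by (simp flip: power_diff)
  have div_iff: "x div u = k \<longleftrightarrow> k * u \<le> x \<and> x < (k + 1) * u" for k
    using less_eq_div_iff_mult_less_eq[OF u, of k x] div_less_iff_less_mult[OF u, of x "k + 1"] by auto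
  have first: "x \<in> {j * (2 * u)..<j * (2 * u) + u} \<longleftrightarrow> x div u = 2 * j"
    unfolding div_iff by (auto simp: algebra_simps)
  have second: "x \<in> {j * (2 * u) + u..<2 * u + j * (2 * u)} \<longleftrightarrow> x div u = Suc (2 * j)"
    unfolding div_iff by (auto simp: algebra_simps)
  have half: "x div (2 * u) = x div u div 2"
    by (simp add: div_mult2_eq mult.commute)
  have "haar_vec (2 ^ n) (int m) j $ x =
    (if x div u = 2 * j then sqrt (2 ^ m / 2 ^ n) else if x div u = 2 * j + 1 then - sqrt (2 ^ m / 2 ^ n) else 0)"
    using x unfolding haar_vec_def by (simp add: Let_def div first second del: atLeastLessThan_iff)
  also have "\<dots> = (if x div u div 2 = j then (if even (x div u) then 1 else -1) * sqrt (2 ^ m / 2 ^ n) else 0)"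
    by (auto elim!: evenE oddE)
  finally show ?thesis
    unfolding w half u_def[symmetric] .
qed

text \<open>Induction on the scale: the partial sum is the kernel of the orthogonal projection onto
  functions constant on the dyadic intervals of length \<open>2 ^ (n - m)\<close>, and the vectors of scale \<open>m\<close>
  refine it to half that length.\<close>

lemma haar_labels_partial_sum:
  assumes "m \<le> n" and x: "x < 2 ^ n" and y: "y < 2 ^ n"
  shows "(\<Sum>(l, j)\<leftarrow>haar_labels (2 ^ m). haar_vec (2 ^ n) l j $ x * haar_vec (2 ^ n) l j $ y) =
    2 ^ m / 2 ^ n * of_bool (x div 2 ^ (n - m) = y div 2 ^ (n - m))"
  using \<open>m \<le> n\<close>
proof (induction m)
  case 0
  then show ?case
    using x y by (simp add: haar_labels_1[simplified] haar_vec_scaling)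
next
  case (Suc m)
  then have m: "m < n" by simp
  \<comment> \<open>The numbers of the finer intervals containing \<open>x\<close> and
    \<open>y\<close>; halving them gives the numbers of the coarser ones.\<close>
  define p q where "p = x div 2 ^ (n - Suc m)" and "q = y div 2 ^ (n - Suc m)"
  have w: "2 ^ (n - m) = 2 ^ (n - Suc m) * (2 :: nat)"
    using m by (simp add: Suc_diff_Suc flip: power_Suc2)
  have half: "x div 2 ^ (n - m) = p div 2" "y div 2 ^ (n - m) = q div 2"
    unfolding w p_def q_def by (simp_all add: div_mult2_eq)
  have bound: "p div 2 < 2 ^ m"
    unfolding half[symmetric] using m x by (intro less_mult_imp_div_less) (simp flip: power_add)
  define s where "s r = (if even r then 1 else -1 :: real)" for r :: nat
  have "(\<Sum>j\<leftarrow>[0..<2 ^ m]. haar_vec (2 ^ n) (int m) j $ x * haar_vec (2 ^ n) (int m) j $ y) =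
    (\<Sum>j<2 ^ m. if j = p div 2 then (if p div 2 = q div 2 then s p * s q * (2 ^ m / 2 ^ n) else 0) else 0)"
    unfolding sum_list_distinct_conv_sum_set[OF distinct_upt]
    by (rule sum.cong) (auto simp: haar_vec_eq[OF m x] haar_vec_eq[OF m y] half s_def p_def[symmetric] q_def[symmetric])
  also have "\<dots> = (if p div 2 = q div 2 then s p * s q * (2 ^ m / 2 ^ n) else 0)"
    using bound by simp
  finally have new: "(\<Sum>j\<leftarrow>[0..<2 ^ m]. haar_vec (2 ^ n) (int m) j $ x * haar_vec (2 ^ n) (int m) j $ y) =
    (if p div 2 = q div 2 then s p * s q * (2 ^ m / 2 ^ n) else 0)" .
  \<comment> \<open>Within a common coarse interval, the old kernel contributes 1 and the new scale
    the product of the signs: 1 + 1 if \<open>x\<close> and \<open>y\<close> lie in the same half, 1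
    - 1 if not.\<close>
  have "p = q" if "p div 2 = q div 2" "even p = even q"
    using that by (metis dvd_imp_mod_0 div_mult_mod_eq odd_iff_mod_2_eq_one)
  then have *: "of_bool (p div 2 = q div 2) + (if p div 2 = q div 2 then s p * s q else 0) = 2 * of_bool (p = q)"
    by (auto simp: s_def)
  have "(\<Sum>(l, j)\<leftarrow>haar_labels (2 ^ Suc m). haar_vec (2 ^ n) l j $ x * haar_vec (2 ^ n) l j $ y) =
    2 ^ m / 2 ^ n * of_bool (p div 2 = q div 2) + (if p div 2 = q div 2 then s p * s q * (2 ^ m / 2 ^ n) else 0)"
    unfolding haar_labels_Suc using Suc m by (simp add: comp_def new half)
  also have "\<dots> = 2 ^ m / 2 ^ n * (of_bool (p div 2 = q div 2) + (if p div 2 = q div 2 then s p * s q else 0))"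
    by (simp add: algebra_simps)
  also have "\<dots> = 2 ^ Suc m / 2 ^ n * of_bool (p = q)"
    unfolding * by simp
  finally show ?case
    unfolding p_def q_def .
qed

lemma dim_haar_mat: "dim_row (haar_mat (2 ^ n)) = 2 ^ n" "dim_col (haar_mat (2 ^ n)) = 2 ^ n"
  by (simp_all add: haar_mat_def length_haar_labels)

lemma haar_mat_index:
  assumes "r < 2 ^ n" "x < 2 ^ n"
  shows "haar_mat (2 ^ n) $$ (r, x) = (case haar_labels (2 ^ n) ! r of (m, j) \<Rightarrow> haar_vec (2 ^ n) m j $ x)"
  using assms by (simp add: haar_mat_def mat_of_rows_index length_haar_labels split: prod.split)

text \<open>The partial sum over all scales: the dyadic intervals now have length 1 and the
  prefactor is \<open>2 ^ n / 2 ^ n\<close>.\<close>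

lemma haar_mat_orthonormal_cols:
  assumes "x < 2 ^ n" "y < 2 ^ n"
  shows "(\<Sum>r<2 ^ n. haar_mat (2 ^ n) $$ (r, x) * haar_mat (2 ^ n) $$ (r, y)) = of_bool (x = y)"
proof -
  have "(\<Sum>r<2 ^ n. haar_mat (2 ^ n) $$ (r, x) * haar_mat (2 ^ n) $$ (r, y)) =
    (\<Sum>(l, j)\<leftarrow>haar_labels (2 ^ n). haar_vec (2 ^ n) l j $ x * haar_vec (2 ^ n) l j $ y)"
    unfolding sum_list_sum_nth length_map length_haar_labels atLeast0LessThan
    using assms by (intro sum.cong) (auto simp: haar_mat_index length_haar_labels split: prod.split)
  then show ?thesis
    using haar_labels_partial_sum[OF order_refl assms] by simp
qed

lemma haar_scale_in_haar_scales:
  assumes "r < 2 ^ n"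
  shows "haar_scale (2 ^ n) r \<in> haar_scales (2 ^ n)"
proof -
  have "haar_labels (2 ^ n) ! r \<in> set (haar_labels (2 ^ n))"
    using assms by (simp add: length_haar_labels)
  then show ?thesis
    using haar_labels_bounds[of "fst (haar_labels (2 ^ n) ! r)" "snd (haar_labels (2 ^ n) ! r)" n]
    by (simp add: haar_scale_def haar_scales_def log_nat_power)
qed

text \<open>The vectors of one scale have disjoint supports, so both rows carry the same label;
  labels are distinct, so the rows coincide.\<close>

lemma haar_mat_single_row:
  assumes "r < 2 ^ n" "r' < 2 ^ n" "x < 2 ^ n" and scale: "haar_scale (2 ^ n) r = haar_scale (2 ^ n) r'"
    and "haar_mat (2 ^ n) $$ (r, x) \<noteq> 0" "haar_mat (2 ^ n) $$ (r', x) \<noteq> 0"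
  shows "r = r'"
proof -
  obtain m j j' where l: "haar_labels (2 ^ n) ! r = (m, j)" "haar_labels (2 ^ n) ! r' = (m, j')"
    using scale by (metis haar_scale_def prod.collapse)
  have mem: "(m, j) \<in> set (haar_labels (2 ^ n))" "(m, j') \<in> set (haar_labels (2 ^ n))"
    using l assms(1,2) length_haar_labels[of n] by (metis nth_mem)+
  have "j = j'"
  \<comment> \<open>The scaling vector is nowhere zero, but scale -1 has just one label. At every
    other scale a nonzero value at \<open>x\<close> determines \<open>j\<close>.\<close>
  proof (cases "m = -1")
    case True
    then show ?thesis using mem[THEN haar_labels_bounds] by simp
  next
    case False
    then have "0 \<le> m" "m < int n"
      using haar_labels_bounds[OF mem(1)] by auto
    then obtain i where i: "m = int i" "i < n"
      by (metis nonneg_int_cases of_nat_less_iff)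
    show ?thesis
      using assms by (simp add: haar_mat_index l i haar_vec_eq split: if_splits)
  qed
  then show ?thesis
    using l assms(1,2) nth_eq_iff_index_eq[OF distinct_haar_labels, of r n r'] by (simp add: length_haar_labels)
qed

section \<open>Kronecker products and grouping of indices by scale\<close>

lemma kronecker_index:
  assumes "A \<in> carrier_mat d d" "B \<in> carrier_mat d d" "i < d\<^sup>2" "x < d\<^sup>2"
  shows "kronecker A B $$ (i, x) = A $$ (i div d, x div d) * B $$ (i mod d, x mod d)"
  using assms by (auto simp: kronecker_def power2_eq_square)

lemma pair_index_less_square:
  assumes "r < d" "s < d"
  shows "r * d + s < (d :: nat)\<^sup>2"
proof -
  have "r * d + s < Suc r * d" using assms by simp
  also have "\<dots> \<le> d * d" using assms by (intro mult_le_mono1) simp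
  finally show ?thesis by (simp add: power2_eq_square)
qed

lemma sum_div_mod:
  fixes f :: "nat \<Rightarrow> nat \<Rightarrow> 'b :: comm_monoid_add"
  assumes d: "d > 0"
  shows "(\<Sum>i<d\<^sup>2. f (i div d) (i mod d)) = (\<Sum>r<d. \<Sum>s<d. f r s)"
proof -
  have "(\<Sum>i<d\<^sup>2. f (i div d) (i mod d)) = (\<Sum>(r, s)\<in>{..<d} \<times> {..<d}. f r s)"
    by (rule sum.reindex_bij_witness[where i = "\<lambda>(r, s). r * d + s" and j = "\<lambda>i. (i div d, i mod d)"])
      (use d in \<open>auto simp: pair_index_less_square[unfolded power2_eq_square] power2_eq_square less_mult_imp_div_less\<close>)
  then show ?thesis by (simp add: sum.cartesian_product)
qed

text \<open>The inner product of two columns factors into the inner products of the corresponding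
  columns of \<open>A\<close> and \<open>B\<close>.\<close>

lemma kronecker_orthonormal_cols:
  fixes A B :: "'b :: comm_semiring_1 Matrix.mat"
  assumes AB: "A \<in> carrier_mat d d" "B \<in> carrier_mat d d" and x: "x < d\<^sup>2" and y: "y < d\<^sup>2"
    and A: "\<And>x y. x < d \<Longrightarrow> y < d \<Longrightarrow> (\<Sum>r<d. A $$ (r, x) * A $$ (r, y)) = of_bool (x = y)"
    and B: "\<And>x y. x < d \<Longrightarrow> y < d \<Longrightarrow> (\<Sum>r<d. B $$ (r, x) * B $$ (r, y)) = of_bool (x = y)"
  shows "(\<Sum>i<d\<^sup>2. kronecker A B $$ (i, x) * kronecker A B $$ (i, y)) = of_bool (x = y)"
proof -
  have d: "d > 0" using x by (cases d) auto
  have "(\<Sum>i<d\<^sup>2. kronecker A B $$ (i, x) * kronecker A B $$ (i, y)) =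
    (\<Sum>i<d\<^sup>2. (A $$ (i div d, x div d) * A $$ (i div d, y div d)) * (B $$ (i mod d, x mod d) * B $$ (i mod d, y mod d)))"
    using x y by (intro sum.cong) (auto simp: kronecker_index[OF AB] mult_ac)
  also have "\<dots> = (\<Sum>r<d. A $$ (r, x div d) * A $$ (r, y div d)) * (\<Sum>s<d. B $$ (s, x mod d) * B $$ (s, y mod d))"
    unfolding sum_product by (rule sum_div_mod[OF d])
  also have "\<dots> = of_bool (x div d = y div d \<and> x mod d = y mod d)"
    using x y d by (simp add: A B less_mult_imp_div_less power2_eq_square of_bool_conj)
  also have "x div d = y div d \<and> x mod d = y mod d \<longleftrightarrow> x = y"
    by (metis div_mult_mod_eq)
  finally show ?thesis .
qed

text \<open>Seen as fibres of one map on \<open>{..<\<Delta>\<^sup>2}\<close>, the index sets are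
  finite and sums over them can be regrouped with \<open>sum.group\<close>.\<close>

lemma scale_indices_eq:
  assumes "\<Delta> > 0"
  shows "scale_indices \<Delta> s = {i \<in> {..<\<Delta>\<^sup>2}. (haar_scale \<Delta> (i div \<Delta>), haar_scale \<Delta> (i mod \<Delta>)) = s}"
proof (intro Set.set_eqI iffI)
  fix i assume "i \<in> scale_indices \<Delta> s"
  then obtain r1 r2 where i: "i = r1 * \<Delta> + r2" "r1 < \<Delta>" "r2 < \<Delta>" "s = (haar_scale \<Delta> r1, haar_scale \<Delta> r2)"
    by (cases s) (auto simp: scale_indices_def)
  then show "i \<in> {i \<in> {..<\<Delta>\<^sup>2}. (haar_scale \<Delta> (i div \<Delta>), haar_scale \<Delta> (i mod \<Delta>)) = s}"
    by (simp add: pair_index_less_square)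
next
  fix i assume i: "i \<in> {i \<in> {..<\<Delta>\<^sup>2}. (haar_scale \<Delta> (i div \<Delta>), haar_scale \<Delta> (i mod \<Delta>)) = s}"
  then have "i div \<Delta> < \<Delta>" "i mod \<Delta> < \<Delta>" "i = i div \<Delta> * \<Delta> + i mod \<Delta>"
    using assms by (simp_all add: power2_eq_square less_mult_imp_div_less)
  with i show "i \<in> scale_indices \<Delta> s"
    unfolding scale_indices_def by (cases s) blast
qed

theorem theorem11:
  fixes P :: "'a measure" and \<Delta> k :: nat
    and v z :: "'a \<Rightarrow> real Matrix.vec" and M :: "real Matrix.mat"
  assumes "prob_space P"
    and "\<exists>n. \<Delta> = 2 ^ n"
    and "k \<ge> 2"
    and "M = kronecker (haar_mat \<Delta>) (haar_mat \<Delta>)"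
    and "\<And>\<omega>. \<omega> \<in> space P \<Longrightarrow> v \<omega> \<in> carrier_vec (\<Delta>\<^sup>2)"
    and "prob_space.indep_vars P
           (\<lambda>s. PiM (scale_indices \<Delta> s) (\<lambda>_. borel))
           (\<lambda>s \<omega>. \<lambda>i \<in> scale_indices \<Delta> s. v \<omega> $ i)
           (haar_scales \<Delta> \<times> haar_scales \<Delta>)"
    and "\<And>s i. s \<in> haar_scales \<Delta> \<times> haar_scales \<Delta> \<Longrightarrow> i \<in> scale_indices \<Delta> s \<Longrightarrow>
           std_gaussian P (\<lambda>\<omega>. v \<omega> $ i)"
    and "\<And>s. s \<in> haar_scales \<Delta> \<times> haar_scales \<Delta> \<Longrightarrow>
           kwise_indep P k (\<lambda>i \<omega>. v \<omega> $ i) (scale_indices \<Delta> s)"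
    and "\<And>\<omega>. \<omega> \<in> space P \<Longrightarrow> z \<omega> = transpose_mat M *\<^sub>v v \<omega>"
  shows "(\<forall>i < \<Delta>\<^sup>2. std_gaussian P (\<lambda>\<omega>. z \<omega> $ i)) \<and>
         kwise_indep P k (\<lambda>i \<omega>. z \<omega> $ i) {..<\<Delta>\<^sup>2}"
proof -
  interpret prob_space P by fact
  obtain n where \<Delta>: "\<Delta> = 2 ^ n" using assms(2) by blast
  have pos: "\<Delta> > 0" by (simp add: \<Delta>)
  define S where "S = haar_scales \<Delta> \<times> haar_scales \<Delta>"
  have H: "haar_mat \<Delta> \<in> carrier_mat \<Delta> \<Delta>"
    by (intro carrier_matI) (simp_all add: \<Delta> dim_haar_mat)
  have M_index: "M $$ (i, x) = haar_mat \<Delta> $$ (i div \<Delta>, x div \<Delta>) * haar_mat \<Delta> $$ (i mod \<Delta>, x mod \<Delta>)"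
    if "i < \<Delta>\<^sup>2" "x < \<Delta>\<^sup>2" for i x
    unfolding assms(4) using H H that by (rule kronecker_index)
  have M: "M \<in> carrier_mat (\<Delta>\<^sup>2) (\<Delta>\<^sup>2)"
    using H unfolding assms(4) kronecker_def by (simp add: power2_eq_square)
  have div_less: "i div \<Delta> < \<Delta>" if "i < \<Delta>\<^sup>2" for i
    using that by (simp add: power2_eq_square less_mult_imp_div_less)
  have S: "finite S"
    by (simp add: S_def haar_scales_def)
  \<comment> \<open>No index is lost: the scale pair of every row belongs to
    \<open>S\<close>.\<close>
  have sum_scales: "(\<Sum>s\<in>S. \<Sum>i\<in>scale_indices \<Delta> s. f i) = (\<Sum>i<\<Delta>\<^sup>2. f i)" for f :: "nat \<Rightarrow> real"
    unfolding scale_indices_eq[OF pos]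
    by (rule sum.group) (use S pos div_less in \<open>auto simp: S_def \<Delta> haar_scale_in_haar_scales\<close>)
  have "(\<forall>x\<in>{..<\<Delta>\<^sup>2}. std_gaussian P (\<lambda>\<omega>. z \<omega> $ x)) \<and> kwise_indep P k (\<lambda>x \<omega>. z \<omega> $ x) {..<\<Delta>\<^sup>2}"
  proof (rule kwise_gaussian_orthonormal_image[where S = S and I = "scale_indices \<Delta>" and c = "\<lambda>i x. M $$ (i, x)"
        and V = "\<lambda>i \<omega>. v \<omega> $ i"])
    show "finite (scale_indices \<Delta> s)" for s
      by (simp add: scale_indices_eq[OF pos])
    show "indep_vars (\<lambda>s. PiM (scale_indices \<Delta> s) (\<lambda>_. borel)) (\<lambda>s \<omega>. \<lambda>i\<in>scale_indices \<Delta> s. v \<omega> $ i) S"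
      unfolding S_def by (rule assms(6))
    show "std_gaussian P (\<lambda>\<omega>. v \<omega> $ i)" if "s \<in> S" "i \<in> scale_indices \<Delta> s" for s i
      using assms(7)[OF that[unfolded S_def]] .
    show "kwise_indep P k (\<lambda>i \<omega>. v \<omega> $ i) (scale_indices \<Delta> s)" if "s \<in> S" for s
      using assms(8)[OF that[unfolded S_def]] .
    show "z \<omega> $ x = (\<Sum>s\<in>S. \<Sum>i\<in>scale_indices \<Delta> s. M $$ (i, x) * v \<omega> $ i)"
      if "x \<in> {..<\<Delta>\<^sup>2}" "\<omega> \<in> space P" for x \<omega>
      unfolding sum_scales assms(9)[OF that(2)] using M that assms(5)[OF that(2)]
      by (simp add: scalar_prod_def atLeast0LessThan)
    show "(\<Sum>s\<in>S. \<Sum>i\<in>scale_indices \<Delta> s. M $$ (i, x) * M $$ (i, y)) = of_bool (x = y)"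
      if "x \<in> {..<\<Delta>\<^sup>2}" "y \<in> {..<\<Delta>\<^sup>2}" for x y
      unfolding sum_scales assms(4) using that
      by (intro kronecker_orthonormal_cols[OF H H]) (auto simp: \<Delta> haar_mat_orthonormal_cols)
    show "i = i'"
      if "x \<in> {..<\<Delta>\<^sup>2}" "i \<in> scale_indices \<Delta> s" "i' \<in> scale_indices \<Delta> s" "M $$ (i, x) \<noteq> 0" "M $$ (i', x) \<noteq> 0"
      for s x i i'
    proof -
      have i: "i < \<Delta>\<^sup>2" "i' < \<Delta>\<^sup>2" "haar_scale \<Delta> (i div \<Delta>) = haar_scale \<Delta> (i' div \<Delta>)"
        "haar_scale \<Delta> (i mod \<Delta>) = haar_scale \<Delta> (i' mod \<Delta>)"
        using that(2,3) by (auto simp: scale_indices_eq[OF pos])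
      have single: "r = r'" if "r < \<Delta>" "r' < \<Delta>" "x < \<Delta>" "haar_scale \<Delta> r = haar_scale \<Delta> r'"
        "haar_mat \<Delta> $$ (r, x) \<noteq> 0" "haar_mat \<Delta> $$ (r', x) \<noteq> 0" for r r' x
        using that unfolding \<Delta> by (rule haar_mat_single_row)
      \<comment> \<open>A nonzero entry of the Kronecker product has two nonzero factors, so
        uniqueness of the row holds in each coordinate separately.\<close>
      have "i div \<Delta> = i' div \<Delta>"
        by (rule single[of _ _ "x div \<Delta>"]) (use that i in \<open>auto simp: M_index div_less\<close>)
      moreover have "i mod \<Delta> = i' mod \<Delta>"
        by (rule single[of _ _ "x mod \<Delta>"]) (use that i pos in \<open>auto simp: M_index\<close>)
      ultimately show ?thesis
        by (metis div_mult_mod_eq)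
    qed
  qed (use S assms(3) in auto)
  then show ?thesis by simp
qed

end
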